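(* Let $M'\ge2$, $\kappa_y>0$, and $$\psi(r;\alpha)=\alpha r^5-18(1-r)^5+45(1+r)^2(1-r)^3+5(1-r)^7(1+r)^{-2}.$$ Define recursively $$r_j^o=\arg\min_{r\in[0,1]}\psi(r;\psi_{j-1}^{\min}),\qquad\psi_j^{\min}=\psi(r_j^o;\psi_{j-1}^{\min}),\qquad\psi_0^{\min}=32,$$ and let the boundaries of the optimal quantizer be $d_0=0$, $d_{M'}=\kappa_y$, $d_j=r_j^od_{j+1}$ for $1\le j\le M'-1$. Let $\mathcal S_j=(d_{j-1},d_j]$ for $1\le j\le M'$, and $\mathcal I_j=\{\tilde\phi_1:\tilde\theta_1\tilde\phi_1\in\mathcal S_j\}$ with $\tilde\theta_1>0$. Then the widths satisfy $$|\mathcal S_j|>|\mathcal S_{j+1}|,\qquad|\mathcal I_j|>|\mathcal I_{j+1}|$$ for all $j>0$ (i.e. $1\le j\le M'-1$).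
   Context: $|\cdot|$ denotes the width (length) of an interval. The quantizer with boundaries $\pm d_j$ is the paper's optimal quantizer for a first-order system ($n=1$) $y=\tilde\theta_1\tilde\phi_1$ with $\tilde\phi_1$ uniformly distributed on $[-\kappa,\kappa]$ and $\kappa_y=\kappa\tilde\theta_1$: among symmetric memoryless quantizers $q$ of $[-\kappa_y,\kappa_y]$ with $M'$ subsections on the positive side, and with error $e(\tilde\phi_1)=q(\tilde\theta_1\tilde\phi_1)-\tilde\theta_1\tilde\phi_1$ satisfying $\int_{\mathcal I_j}\tilde\phi_1e(\tilde\phi_1)\,d\tilde\phi_1=0$ for all $j$, it minimizes $\int_{-\kappa}^{\kappa}\tilde\phi_1^2e^2(\tilde\phi_1)\,d\tilde\phi_1$. *)

theory Defs
  imports "HOL-Analysis.Analysis"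
begin

definition psi :: "real \<Rightarrow> real \<Rightarrow> real" where
  "psi r \<alpha> = \<alpha> * r ^ 5 - 18 * (1 - r) ^ 5 + 45 * (1 + r)\<^sup>2 * (1 - r) ^ 3
              + 5 * (1 - r) ^ 7 * (1 + r) powi (-2)"

(* The sequences r (optimal ratios) and p (minimal values) of the recursion; r 0 is irrelevant.
   "r j = arg min" is read as "r j is a minimiser", so the predicate does not rely on the
   minimiser being unique. *)
definition optimal_ratios :: "(nat \<Rightarrow> real) \<Rightarrow> (nat \<Rightarrow> real) \<Rightarrow> bool" where
  "optimal_ratios r p \<longleftrightarrow> p 0 = 32 \<and>
     (\<forall>j\<ge>1. is_arg_min (\<lambda>x. psi x (p (j - 1))) (\<lambda>x. x \<in> {0..1}) (r j) \<and>
            p j = psi (r j) (p (j - 1)))"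

(* The boundaries d 0, ..., d M of the quantizer on the nonnegative half-axis; values of d
   beyond M are unconstrained. *)
definition optimal_boundaries :: "nat \<Rightarrow> real \<Rightarrow> (nat \<Rightarrow> real) \<Rightarrow> (nat \<Rightarrow> real) \<Rightarrow> bool" where
  "optimal_boundaries M \<kappa> r d \<longleftrightarrow> d 0 = 0 \<and> d M = \<kappa> \<and> (\<forall>j\<in>{1..M - 1}. d j = r j * d (j + 1))"

definition output_interval :: "(nat \<Rightarrow> real) \<Rightarrow> nat \<Rightarrow> real set" where
  "output_interval d j = {d (j - 1) <.. d j}"

definition input_interval :: "real \<Rightarrow> (nat \<Rightarrow> real) \<Rightarrow> nat \<Rightarrow> real set" where
  "input_interval \<theta> d j = {\<phi>. \<theta> * \<phi> \<in> output_interval d j}"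

abbreviation width :: "real set \<Rightarrow> real" where
  "width \<equiv> measure lborel"

(* The minima in the recursion are attained. *)
lemma optimal_ratios_exist: "\<exists>r p. optimal_ratios r p"
proof -
  have ex: "\<exists>x. is_arg_min (\<lambda>x. psi x a) (\<lambda>x. x \<in> {0..1}) x" for a
  proof -
    have "continuous_on {0..1} (\<lambda>x. psi x a)"
      unfolding psi_def by (intro continuous_intros) auto
    then obtain x where "x \<in> {0..1}" "\<forall>y\<in>{0..1}. psi x a \<le> psi y a"
      using continuous_attains_inf[of "{0..1::real}" "\<lambda>x. psi x a"] by auto
    then show ?thesis
      unfolding is_arg_min_linorder by blast
  qed
  define g where "g a = (SOME x. is_arg_min (\<lambda>x. psi x a) (\<lambda>x. x \<in> {0..1}) x)" for a
  have g: "is_arg_min (\<lambda>x. psi x a) (\<lambda>x. x \<in> {0..1}) (g a)" for a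
    unfolding g_def using ex[of a] by (rule someI_ex)
  define p where "p = rec_nat 32 (\<lambda>_ a. psi (g a) a)"
  have "p j = psi (g (p (j - 1))) (p (j - 1))" if "j \<ge> 1" for j
    using that by (cases j) (simp_all add: p_def)
  then have "optimal_ratios (\<lambda>j. g (p (j - 1))) p"
    unfolding optimal_ratios_def using g by (simp add: p_def)
  then show ?thesis
    by blast
qed

end

theory Submission
  imports Defs
begin

text \<open>
  Write \<open>g(r) = psi r 0\<close>, so that \<open>psi r \<alpha> = \<alpha> r^5 + g(r)\<close>.  Homogenising \<open>g\<close> to degree 5 gives
  the cost \<open>C(a,b)\<close> of a cell with end points \<open>a\<close> and \<open>b\<close>, where \<open>C(r,1) = g(r)\<close>; every term of
  \<open>C\<close> contains an odd power of \<open>b - a\<close> and is otherwise symmetric, hence \<open>C(b,a) = - C(a,b)\<close>.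
  Put \<open>B(r) = C_b(r,1) / 5\<close>.  Antisymmetry and homogeneity yield \<open>C_a(r,1) = - 5 r^4 B(1/r)\<close>, so
  the derivative of \<open>psi\<close> in \<open>r\<close> is \<open>5 r^4 (\<alpha> - B(1/r))\<close>, and Euler's identity
  \<open>a C_a + b C_b = 5 C\<close> shows that the value of \<open>psi\<close> at a stationary point \<open>r\<close> is \<open>B(r)\<close>.
  Consequently the recursion for consecutive ratios \<open>x\<close>, \<open>r\<close> collapses to \<open>B(1/r) = B(x)\<close>, and
  the start value 32 is \<open>B(0)\<close>.

  The desired inequality between consecutive widths, \<open>d_j (1 - x) > d_{j+1} (1 - r)\<close> with
  \<open>d_j = r d_{j+1}\<close>, says \<open>1/r < 2 - x\<close>.  Now \<open>B(t) = (t - 1)^2 b(t)\<close>, with \<open>b\<close> strictly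
  increasing on the nonnegative axis.  The points \<open>x < 1\<close> and \<open>2 - x > 1\<close> are mirror images about
  1, so the quadratic factor agrees at them and \<open>B(x) < B(2 - x)\<close>; since \<open>B\<close> increases to the
  right of 1, \<open>B(1/r) = B(x) < B(2 - x)\<close> forces \<open>1/r < 2 - x\<close>.  What remains is that minimisers
  are interior, so that they are indeed stationary.
\<close>

section \<open>The marginal cost of a cell\<close>

text \<open>The function \<open>b\<close> of the introduction: what breaks the symmetry of \<open>B\<close> about 1.\<close>
definition skew_factor :: "real \<Rightarrow> real" where
  "skew_factor t = 16 * (2 * t ^ 4 + 19 * t ^ 3 + 21 * t\<^sup>2 + 10 * t + 2) / (1 + t) ^ 3"

text \<open>The function \<open>B\<close> of the introduction, that is, one fifth of the derivative of the cell cost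
  with respect to the upper end point.\<close>
definition marginal_cost :: "real \<Rightarrow> real" where
  "marginal_cost t = (t - 1)\<^sup>2 * skew_factor t"

lemma skew_factor_pos:
  assumes "t \<ge> 0"
  shows "skew_factor t > 0"
  using assms unfolding skew_factor_def
  by (intro divide_pos_pos mult_pos_pos add_nonneg_pos) auto

text \<open>The numerator of the derivative is a polynomial with positive coefficients.\<close>
lemma skew_factor_strict_mono:
  assumes "0 \<le> s" "s < t"
  shows "skew_factor s < skew_factor t"
proof (rule DERIV_pos_imp_increasing[OF \<open>s < t\<close>])
  fix x :: real
  assume "s \<le> x" "x \<le> t"
  with assms have x: "x \<ge> 0" by simp
  define D where "D = 32 * (x ^ 4 + 4 * x ^ 3 + 18 * x\<^sup>2 + 11 * x + 2) / (1 + x) ^ 4"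
  have "(skew_factor has_real_derivative D) (at x)"
    unfolding skew_factor_def [abs_def] D_def using x
    apply (auto intro!: derivative_eq_intros)
    apply (simp add: divide_simps)
    apply algebra
    done
  moreover have "D > 0"
    unfolding D_def using x by (intro divide_pos_pos mult_pos_pos add_nonneg_pos) auto
  ultimately show "\<exists>y. (skew_factor has_real_derivative y) (at x) \<and> 0 < y"
    by blast
qed

lemma marginal_cost_pos:
  assumes "0 \<le> t" "t < 1"
  shows "marginal_cost t > 0"
  using assms skew_factor_pos[of t] by (simp add: marginal_cost_def)

lemma marginal_cost_mono:
  assumes "1 \<le> s" "s \<le> t"
  shows "marginal_cost s \<le> marginal_cost t"
  unfolding marginal_cost_def
proof (rule mult_mono)
  show "(s - 1)\<^sup>2 \<le> (t - 1)\<^sup>2"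
    using assms by (intro power_mono) auto
  show "skew_factor s \<le> skew_factor t"
    using assms skew_factor_strict_mono[of s t] by (cases "s = t") auto
qed (use assms skew_factor_pos[of s] in auto)

text \<open>Reflection about 1 leaves the quadratic factor unchanged, so only the monotone factor
  distinguishes the two sides.\<close>
lemma marginal_cost_reflect:
  assumes "0 \<le> x" "x < 1"
  shows "marginal_cost x < marginal_cost (2 - x)"
proof -
  have "(x - 1)\<^sup>2 * skew_factor x < (x - 1)\<^sup>2 * skew_factor (2 - x)"
    using assms skew_factor_strict_mono[of x "2 - x"] by (intro mult_strict_left_mono) auto
  also have "(x - 1)\<^sup>2 = (2 - x - 1)\<^sup>2"
    by (simp add: power2_eq_square algebra_simps)
  finally show ?thesis
    by (simp add: marginal_cost_def power2_commute)
qed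

section \<open>Minimisers of the recursion\<close>

lemma marginal_cost_inverse:
  assumes "r > 0"
  shows "marginal_cost (1 / r) =
    (1 - r)\<^sup>2 * (16 * (2 + 19 * r + 21 * r\<^sup>2 + 10 * r ^ 3 + 2 * r ^ 4)) / (r ^ 3 * (1 + r) ^ 3)"
proof -
  have "1 + 1 / r = (1 + r) / r" "1 / r - 1 = (1 - r) / r"
    using assms by (simp_all add: field_simps)
  moreover have "1 + r \<noteq> 0" "r \<noteq> 0"
    using assms by auto
  ultimately show ?thesis
    unfolding marginal_cost_def skew_factor_def
    by (simp add: power_divide divide_simps) algebra
qed

text \<open>Moving the boundary \<open>r\<close> trades the cost below it, of rate \<open>5 r^4 \<alpha>\<close>, against that of the cell
  above it; by antisymmetry and scaling, the latter rate is that of the upper end point of a cell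
  from \<open>1/r\<close> to 1.\<close>
lemma psi_has_derivative:
  assumes "r > 0"
  shows "((\<lambda>x. psi x \<alpha>) has_real_derivative 5 * r ^ 4 * (\<alpha> - marginal_cost (1 / r))) (at r)"
proof -
  have *: "psi x \<alpha> = \<alpha> * x ^ 5 - 18 * (1 - x) ^ 5 + 45 * (1 + x)\<^sup>2 * (1 - x) ^ 3
              + 5 * (1 - x) ^ 7 / (1 + x)\<^sup>2" for x
    by (simp add: psi_def power_int_def field_simps)
  have "1 + r \<noteq> 0" "r \<noteq> 0"
    using assms by auto
  then show ?thesis
    unfolding * marginal_cost_inverse[OF assms]
    apply (auto intro!: derivative_eq_intros)
    apply (simp add: divide_simps)
    apply algebra
    done
qed

text \<open>The point \<open>r\<close> is stationary exactly for the parameter \<open>marginal_cost (1 / r)\<close>; there only the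
  upper end point contributes to Euler's identity for the total cost.\<close>
lemma psi_at_stationary:
  assumes "r > 0"
  shows "psi r (marginal_cost (1 / r)) = marginal_cost r"
proof -
  have "1 + r \<noteq> 0" "r \<noteq> 0"
    using assms by auto
  then show ?thesis
    unfolding marginal_cost_inverse[OF assms] psi_def marginal_cost_def skew_factor_def
    by (simp add: power_int_def divide_simps) algebra
qed

lemma psi_zero: "psi 0 \<alpha> = 32"
  by (simp add: psi_def)

text \<open>For parameters up to 32, the end point 0 loses against \<open>1/2\<close>, and at 1 the function is increasing because its
  derivative there is \<open>5 * \<alpha>\<close>.\<close>
lemma psi_minimiser_interior:
  assumes "0 < \<alpha>" "\<alpha> \<le> 32"
    and r: "r \<in> {0..1}" and min: "\<And>y. y \<in> {0..1} \<Longrightarrow> psi r \<alpha> \<le> psi y \<alpha>"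
  shows "0 < r" "r < 1"
proof -
  have "psi (1 / 2) \<alpha> < psi 0 \<alpha>"
    using assms(2) by (simp add: psi_def power_int_def field_simps)
  with min[of "1 / 2"] have "r \<noteq> 0"
    by auto
  moreover have "r \<noteq> 1"
  proof
    assume "r = 1"
    have "((\<lambda>x. psi x \<alpha>) has_real_derivative 5 * \<alpha>) (at 1)"
      using psi_has_derivative[of 1 \<alpha>] by (simp add: marginal_cost_def)
    from DERIV_pos_inc_left[OF this] assms(1) obtain e where
      e: "e > 0" "\<And>h. 0 < h \<Longrightarrow> h < e \<Longrightarrow> psi (1 - h) \<alpha> < psi 1 \<alpha>"
      by auto
    define h where "h = min (e / 2) 1"
    have "0 < h" "h < e" "1 - h \<in> {0..1}"
      using e(1) by (auto simp: h_def)
    with e(2)[of h] min[of "1 - h"] \<open>r = 1\<close> show False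
      by auto
  qed
  ultimately show "0 < r" "r < 1"
    using r by auto
qed

lemma psi_minimiser_stationary:
  assumes "0 < \<alpha>" "\<alpha> \<le> 32"
    and "r \<in> {0..1}" and min: "\<And>y. y \<in> {0..1} \<Longrightarrow> psi r \<alpha> \<le> psi y \<alpha>"
  shows "marginal_cost (1 / r) = \<alpha>"
proof -
  have r: "0 < r" "r < 1"
    using psi_minimiser_interior[OF assms] by auto
  have "5 * r ^ 4 * (\<alpha> - marginal_cost (1 / r)) = 0"
  proof (rule DERIV_local_min[OF psi_has_derivative[OF r(1)]])
    show "0 < min r (1 - r)"
      using r by simp
    show "\<forall>y. \<bar>r - y\<bar> < min r (1 - r) \<longrightarrow> psi r \<alpha> \<le> psi y \<alpha>"
      by (intro allI impI min) auto
  qed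
  then show ?thesis
    using r by simp
qed

section \<open>Consecutive ratios and widths\<close>

text \<open>The value \<open>x = 0\<close> is the ratio \<open>d 0 / d 1\<close>, which lets the first step of the recursion be
  treated like the others.\<close>
lemma ratio_step:
  assumes x: "0 \<le> x" "x < 1" and le: "marginal_cost x \<le> 32"
    and r: "r \<in> {0..1}"
    and min: "\<And>y. y \<in> {0..1} \<Longrightarrow> psi r (marginal_cost x) \<le> psi y (marginal_cost x)"
  shows "0 < r" "r < 1" "1 < r * (2 - x)"
    "psi r (marginal_cost x) = marginal_cost r" "marginal_cost r \<le> 32"
proof -
  note pos = marginal_cost_pos[OF x]
  show r01: "0 < r" "r < 1"
    using psi_minimiser_interior[OF pos le r min] by auto
  have stat: "marginal_cost (1 / r) = marginal_cost x"
    by (rule psi_minimiser_stationary[OF pos le r min])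
  have "\<not> 2 - x \<le> 1 / r"
    using marginal_cost_mono[of "2 - x" "1 / r"] marginal_cost_reflect[OF x] stat x by auto
  then show "1 < r * (2 - x)"
    using r01 by (simp add: field_simps)
  show val: "psi r (marginal_cost x) = marginal_cost r"
    using psi_at_stationary[OF r01(1)] stat by simp
  show "marginal_cost r \<le> 32"
    using min[of 0] val by (simp add: psi_zero)
qed

text \<open>The minimum never exceeds the value 32 that \<open>psi\<close> takes at 0, whatever the parameter; carrying
  this bound along the recursion is what keeps every minimiser away from 0.\<close>
lemma optimal_ratios_step:
  assumes "optimal_ratios r p"
  defines "\<rho> \<equiv> r(0 := 0)"
  shows "0 \<le> \<rho> j \<and> \<rho> j < 1 \<and> p j = marginal_cost (\<rho> j) \<and> p j \<le> 32 \<and>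
    0 < \<rho> (Suc j) \<and> 1 < \<rho> (Suc j) * (2 - \<rho> j)"
proof -
  have arg: "r (Suc k) \<in> {0..1}" "\<And>y. y \<in> {0..1} \<Longrightarrow> psi (r (Suc k)) (p k) \<le> psi y (p k)"
    and val: "p (Suc k) = psi (r (Suc k)) (p k)" for k
    using assms(1) unfolding optimal_ratios_def is_arg_min_linorder
    by (auto dest!: spec[of _ "Suc k"])
  have inv: "0 \<le> \<rho> j \<and> \<rho> j < 1 \<and> p j = marginal_cost (\<rho> j) \<and> p j \<le> 32"
  proof (induction j)
    case 0
    then show ?case
      using assms(1) by (simp add: optimal_ratios_def \<rho>_def marginal_cost_def skew_factor_def)
  next
    case (Suc k)
    then have le: "0 \<le> \<rho> k" "\<rho> k < 1" "marginal_cost (\<rho> k) \<le> 32" "p k = marginal_cost (\<rho> k)"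
      by auto
    have "r (Suc k) < 1" "p (Suc k) = marginal_cost (r (Suc k))" "marginal_cost (r (Suc k)) \<le> 32"
      using ratio_step[OF le(1-3) arg(1)[of k]] arg(2)[of _ k] val[of k] unfolding le(4) by metis+
    then show ?case
      using arg(1)[of k] by (simp add: \<rho>_def)
  qed
  then have le: "0 \<le> \<rho> j" "\<rho> j < 1" "marginal_cost (\<rho> j) \<le> 32" and eq: "p j = marginal_cost (\<rho> j)"
    by auto
  have "0 < r (Suc j)" "1 < r (Suc j) * (2 - \<rho> j)"
    using ratio_step[OF le arg(1)[of j]] arg(2)[of _ j] unfolding eq by blast+
  with inv show ?thesis
    by (simp add: \<rho>_def)
qed

lemma width_output_interval:
  assumes "d (j - 1) \<le> d j"
  shows "width (output_interval d j) = d j - d (j - 1)"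
  using assms by (simp add: output_interval_def)

lemma width_input_interval:
  assumes "\<theta> > 0" "d (j - 1) \<le> d j"
  shows "width (input_interval \<theta> d j) = (d j - d (j - 1)) / \<theta>"
proof -
  have "input_interval \<theta> d j = {d (j - 1) / \<theta> <.. d j / \<theta>}"
    using assms(1) by (auto simp: input_interval_def output_interval_def field_simps)
  then show ?thesis
    using assms by (simp add: divide_right_mono diff_divide_distrib)
qed

theorem lemma4p3:
  fixes M :: nat and \<kappa>y \<theta> :: real and r p d :: "nat \<Rightarrow> real"
  assumes "M \<ge> 2" and "\<kappa>y > 0" and "\<theta> > 0"
    and "optimal_ratios r p"
    and "optimal_boundaries M \<kappa>y r d"
  shows "\<forall>j\<in>{1..M - 1}.
           width (output_interval d j) > width (output_interval d (j + 1)) \<and>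
           width (input_interval \<theta> d j) > width (input_interval \<theta> d (j + 1))"
proof
  fix j
  assume j: "j \<in> {1..M - 1}"
  define \<rho> where "\<rho> = r(0 := 0)"
  note \<rho> = optimal_ratios_step[OF assms(4), folded \<rho>_def]
  have d: "d k = \<rho> k * d (Suc k)" if "k < M" for k
    using assms(5) that by (cases "k = 0") (auto simp: optimal_boundaries_def \<rho>_def)
  have pos: "d (Suc k) > 0" if "Suc k \<le> M" for k
    using that
  proof (induction rule: inc_induct)
    case base
    then show ?case
      using assms(2,5) by (simp add: optimal_boundaries_def)
  next
    case (step n)
    then obtain m where "n = Suc m"
      by (cases n) auto
    with step show ?case
      using d[of n] \<rho>[of m] by simp
  qed
  obtain i where i: "j = Suc i" "Suc (Suc i) \<le> M"
    using j by (cases j) auto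
  have eq: "d i = \<rho> i * d (Suc i)" "d (Suc i) = \<rho> (Suc i) * d (Suc (Suc i))"
    using d[of i] d[of "Suc i"] i by auto
  have dpos: "d (Suc i) > 0" "d (Suc (Suc i)) > 0"
    using pos[of i] pos[of "Suc i"] i by auto
  have mono: "d i \<le> d (Suc i)" "d (Suc i) \<le> d (Suc (Suc i))"
    using \<rho>[of i] \<rho>[of "Suc i"] dpos eq
      mult_right_mono[of "\<rho> i" 1 "d (Suc i)"] mult_right_mono[of "\<rho> (Suc i)" 1 "d (Suc (Suc i))"]
    by simp_all
  have "d (Suc (Suc i)) * 1 < d (Suc (Suc i)) * (\<rho> (Suc i) * (2 - \<rho> i))"
    using \<rho>[of i] dpos by (intro mult_strict_left_mono) auto
  also have "\<dots> = d (Suc i) * (2 - \<rho> i)"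
    by (simp add: eq(2))
  finally have less: "d (Suc (Suc i)) - d (Suc i) < d (Suc i) - d i"
    using eq(1) by (simp add: algebra_simps)
  then show "width (output_interval d j) > width (output_interval d (j + 1)) \<and>
      width (input_interval \<theta> d j) > width (input_interval \<theta> d (j + 1))"
    using mono assms(3) i(1)
      width_output_interval[of d j] width_output_interval[of d "j + 1"]
      width_input_interval[of \<theta> d j] width_input_interval[of \<theta> d "j + 1"]
    by (simp add: divide_strict_right_mono)
qed

end
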